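(* Let $G$ and $H$ be connected graphs, each of order at least two. If $G\cong K_{2}$ or $H\cong K_{2}$, then $\chi_{i}(G\times H)=\max\{\chi_{i}(G),\chi_{i}(H)\}$. If $\Delta(G)\geq 2$ and $\Delta(H)\geq2$, then $$\max\{\chi_{i}(G)+\Delta(H),\ \chi_{i}(H)+\Delta(G)\}\leq \chi_{i}(G\times H)\leq \chi_{i}(G)\chi_{i}(H),$$ and both of these bounds are sharp (each is attained with equality by some pair of connected graphs $G,H$ with $\Delta(G),\Delta(H)\ge 2$).
   Context: All graphs are finite and simple. An injective $k$-coloring of a graph $G$ is a function $f:V(G)\to\{1,\dots,k\}$ such that no vertex is adjacent to two distinct vertices $u,w$ with $f(u)=f(w)$ (adjacent vertices may share a color). The injective chromatic number $\chi_i(G)$ is the minimum $k$ for which $G$ admits an injective $k$-coloring. $\Delta(G)$ is the maximum degree of $G$. The direct product $G\times H$ has vertex set $V(G)\times V(H)$, with $(g,h)(g',h')$ an edge iff $gg'\in E(G)$ and $hh'\in E(H)$. *)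

theory Defs
  imports "Graph_Theory.Graph_Theory"
begin

text \<open>
  A finite simple graph is a \<^locale>\<open>pair_graph\<close>: a finite vertex set together with a symmetric,
  irreflexive set of arcs, an edge being represented by its two opposite arcs.  Accordingly the
  degree of a vertex is its out-degree, and a graph is isomorphic to the complete graph on
  \<open>n\<close> vertices iff it satisfies the predicate \<^term>\<open>complete_digraph n\<close>.
\<close>

definition max_degree :: "'a pair_pre_digraph \<Rightarrow> nat" where
  "max_degree G = Max (out_degree (with_proj G) ` pverts G)"

definition injective_coloring :: "'a pair_pre_digraph \<Rightarrow> nat \<Rightarrow> ('a \<Rightarrow> nat) \<Rightarrow> bool" where
  "injective_coloring G k f \<longleftrightarrow>
     (\<forall>v \<in> pverts G. f v \<in> {1..k}) \<and>
     \<not> (\<exists>v \<in> pverts G. \<exists>u w. (v, u) \<in> parcs G \<and> (v, w) \<in> parcs G \<and> u \<noteq> w \<and> f u = f w)"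

definition injective_chromatic_number :: "'a pair_pre_digraph \<Rightarrow> nat" where
  "injective_chromatic_number G = (LEAST k. \<exists>f. injective_coloring G k f)"

definition direct_product ::
    "'a pair_pre_digraph \<Rightarrow> 'b pair_pre_digraph \<Rightarrow> ('a \<times> 'b) pair_pre_digraph" where
  "direct_product G H =
     \<lparr> pverts = pverts G \<times> pverts H,
       parcs = {((g, h), (g', h')) | g h g' h'. (g, g') \<in> parcs G \<and> (h, h') \<in> parcs H} \<rparr>"

lemma pair_graph_direct_product:
  assumes "pair_graph G" "pair_graph H"
  shows "pair_graph (direct_product G H)"
proof -
  interpret G: pair_graph G by fact
  interpret H: pair_graph H by fact
  have sub: "parcs (direct_product G H) \<subseteq>
      (pverts G \<times> pverts H) \<times> (pverts G \<times> pverts H)"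
    by (auto simp: direct_product_def dest: G.wellformed' H.wellformed')
  show ?thesis
  proof unfold_locales
    show "finite (parcs (direct_product G H))"
      by (rule finite_subset[OF sub]) simp
    show "symmetric (with_proj (direct_product G H))"
      unfolding symmetric_def
      by (auto simp: direct_product_def sym_def intro: G.arcs_symmetric H.arcs_symmetric)
  qed (auto simp: direct_product_def dest: G.wellformed' H.wellformed' G.no_loops' H.no_loops')
qed

text \<open>The minimum defining the injective chromatic number is attained.\<close>

lemma ex_injective_coloring:
  assumes "pair_graph G"
  shows "\<exists>f. injective_coloring G (injective_chromatic_number G) f"
proof -
  interpret pair_graph G by fact
  obtain f where f: "bij_betw f (pverts G) {1..card (pverts G)}"
    using ex_bij_betw_nat_finite_1[OF pair_finite_verts] bij_betw_inv by metis
  have inj: "inj_on f (pverts G)" and im: "f ` pverts G = {1..card (pverts G)}"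
    using f by (simp_all add: bij_betw_def)
  have "\<forall>v \<in> pverts G. f v \<in> {1..card (pverts G)}"
    using im by (metis imageI)
  moreover have "u = w" if "(v, u) \<in> parcs G" "(v, w) \<in> parcs G" "f u = f w" for v u w
    using inj_onD[OF inj that(3)] that(1,2) by (auto dest: in_arcsD2)
  ultimately have "injective_coloring G (card (pverts G)) f"
    unfolding injective_coloring_def by metis
  then have "\<exists>f. injective_coloring G (card (pverts G)) f"
    by blast
  then show ?thesis
    unfolding injective_chromatic_number_def
    by (rule LeastI)
qed

end

theory Submission
  imports Defs
begin

text \<open>
  An injective coloring is a proper coloring of the two-step graph, in which distinct vertices with a
  common neighbor are adjacent, and without isolated vertices the two-step graph of a direct product
  is the strong product of the two-step graphs of the factors.  Pairing colors gives the upper bound.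
  For the lower bound, the \<open>m = \<Delta>(H)\<close> neighbors of a vertex of \<open>H\<close> form a clique, so a \<open>k\<close>-coloring of
  the product assigns to every vertex of \<open>G\<close> an \<open>m\<close>-set of colors, disjoint for adjacent vertices of the
  two-step graph; coloring \<open>g\<close> by the minimum of its set, truncated at \<open>k - m\<close>, is still proper
  because \<open>m \<ge> 2\<close>.  For the path on three vertices both bounds are equal to 4.
\<close>

section \<open>Elementary facts on injective colorings and direct products\<close>

lemma injective_coloring_range:
  "injective_coloring G k f \<Longrightarrow> v \<in> pverts G \<Longrightarrow> f v \<in> {1..k}"
  unfolding injective_coloring_def by blast

lemma injective_coloringD:
  assumes "injective_coloring G k f" "v \<in> pverts G" "(v, u) \<in> parcs G" "(v, w) \<in> parcs G" "f u = f w"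
  shows "u = w"
  using assms unfolding injective_coloring_def by blast

lemma injective_coloringI:
  assumes "\<And>v. v \<in> pverts G \<Longrightarrow> f v \<in> {1..k}"
    and "\<And>v u w. \<lbrakk>v \<in> pverts G; (v, u) \<in> parcs G; (v, w) \<in> parcs G; u \<noteq> w\<rbrakk> \<Longrightarrow> f u \<noteq> f w"
  shows "injective_coloring G k f"
  using assms unfolding injective_coloring_def by blast

lemma injective_chromatic_number_le:
  "injective_coloring G k f \<Longrightarrow> injective_chromatic_number G \<le> k"
  unfolding injective_chromatic_number_def by (rule Least_le) blast

lemma parcs_direct_product [simp]:
  "((g, h), (g', h')) \<in> parcs (direct_product G H) \<longleftrightarrow> (g, g') \<in> parcs G \<and> (h, h') \<in> parcs H"
  by (auto simp: direct_product_def)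

lemma pverts_direct_product [simp]: "pverts (direct_product G H) = pverts G \<times> pverts H"
  by (simp add: direct_product_def)

lemma injective_chromatic_number_pos:
  assumes "pair_graph G" "v \<in> pverts G"
  shows "1 \<le> injective_chromatic_number G"
proof -
  obtain f where "injective_coloring G (injective_chromatic_number G) f"
    using ex_injective_coloring[OF assms(1)] by blast
  from injective_coloring_range[OF this assms(2)] show ?thesis by simp
qed

text \<open>Swapping coordinates is an isomorphism between the two products, so colorings pull back
  along it.\<close>

lemma injective_chromatic_number_direct_product_commute_le:
  assumes "pair_graph G" "pair_graph H"
  shows "injective_chromatic_number (direct_product G H) \<le> injective_chromatic_number (direct_product H G)"
proof -
  let ?k = "injective_chromatic_number (direct_product H G)"
  obtain f where f: "injective_coloring (direct_product H G) ?k f"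
    using ex_injective_coloring[OF pair_graph_direct_product[OF assms(2,1)]] by blast
  have "injective_coloring (direct_product G H) ?k (f \<circ> prod.swap)"
  proof (rule injective_coloringI)
    fix v assume "v \<in> pverts (direct_product G H)"
    then show "(f \<circ> prod.swap) v \<in> {1..?k}"
      using injective_coloring_range[OF f, of "prod.swap v"] by auto
  next
    fix v u w
    assume "v \<in> pverts (direct_product G H)" "(v, u) \<in> parcs (direct_product G H)"
      "(v, w) \<in> parcs (direct_product G H)" "u \<noteq> w"
    then show "(f \<circ> prod.swap) u \<noteq> (f \<circ> prod.swap) w"
      using injective_coloringD[OF f, of "prod.swap v" "prod.swap u" "prod.swap w"]
      by (cases v; cases u; cases w) auto
  qed
  then show ?thesis by (rule injective_chromatic_number_le)
qed

lemma injective_chromatic_number_direct_product_commute: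
  assumes "pair_graph G" "pair_graph H"
  shows "injective_chromatic_number (direct_product G H) = injective_chromatic_number (direct_product H G)"
  using injective_chromatic_number_direct_product_commute_le[OF assms]
    injective_chromatic_number_direct_product_commute_le[OF assms(2,1)] by (rule antisym)

section \<open>Upper bound by pairing colors, lower bound by a single layer\<close>

lemma injective_chromatic_number_direct_product_le:
  assumes "pair_graph G" "pair_graph H"
  shows "injective_chromatic_number (direct_product G H)
           \<le> injective_chromatic_number G * injective_chromatic_number H"
proof -
  let ?k = "injective_chromatic_number G" and ?l = "injective_chromatic_number H"
  interpret G: pair_graph G by fact
  interpret H: pair_graph H by fact
  obtain f where f: "injective_coloring G ?k f" using ex_injective_coloring[OF assms(1)] by blast
  obtain e where e: "injective_coloring H ?l e" using ex_injective_coloring[OF assms(2)] by blast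
  \<comment> \<open>\<open>p\<close> renumbers the pairs of factor colors as single colors.\<close>
  obtain p where p: "bij_betw p ({1..?k} \<times> {1..?l}) {1..?k * ?l}"
    using finite_same_card_bij[of "{1..?k} \<times> {1..?l}" "{1..?k * ?l}"] by auto
  define c where "c = (\<lambda>(g, h). p (f g, e h))"
  have "injective_coloring (direct_product G H) (?k * ?l) c"
  proof (rule injective_coloringI)
    fix v assume "v \<in> pverts (direct_product G H)"
    then have "(f (fst v), e (snd v)) \<in> {1..?k} \<times> {1..?l}"
      using injective_coloring_range[OF f] injective_coloring_range[OF e] by auto
    then show "c v \<in> {1..?k * ?l}"
      using bij_betwE[OF p] by (auto simp: c_def split: prod.split)
  next
    fix v u w
    assume v: "v \<in> pverts (direct_product G H)" and vu: "(v, u) \<in> parcs (direct_product G H)"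
      and vw: "(v, w) \<in> parcs (direct_product G H)" and "u \<noteq> w"
    obtain g h g1 h1 g2 h2 where eq: "v = (g, h)" "u = (g1, h1)" "w = (g2, h2)"
      by (metis surj_pair)
    have arcs: "g \<in> pverts G" "h \<in> pverts H" "(g, g1) \<in> parcs G" "(g, g2) \<in> parcs G"
      "(h, h1) \<in> parcs H" "(h, h2) \<in> parcs H"
      using v vu vw eq by auto
    \<comment> \<open>Distinct \<open>u\<close> and \<open>w\<close> differ in some coordinate;
      there they are two neighbors of one vertex of that factor, so the factor coloring separates
      them.\<close>
    have "(f g1, e h1) \<noteq> (f g2, e h2)"
      using injective_coloringD[OF f arcs(1,3,4)] injective_coloringD[OF e arcs(2,5,6)] \<open>u \<noteq> w\<close> eq
      by auto
    moreover have "(f g1, e h1) \<in> {1..?k} \<times> {1..?l}" "(f g2, e h2) \<in> {1..?k} \<times> {1..?l}"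
      using injective_coloring_range[OF f G.in_arcsD2] injective_coloring_range[OF e H.in_arcsD2] arcs
      by blast+
    ultimately show "c u \<noteq> c w"
      by (simp add: c_def eq inj_on_eq_iff[OF bij_betw_imp_inj_on[OF p]])
  qed
  then show ?thesis by (rule injective_chromatic_number_le)
qed

text \<open>The layer over \<open>h'\<close> inherits a coloring: a common neighbor \<open>v\<close>
  of \<open>u\<close> and \<open>w\<close> lifts to the common neighbor \<open>(v, h)\<close> of
  \<open>(u, h')\<close> and \<open>(w, h')\<close>. This serves as the lower bound when one factor
  is \<open>K2\<close>.\<close>

lemma injective_chromatic_number_le_direct_product:
  assumes "pair_graph G" "pair_graph H" and hh: "(h, h') \<in> parcs H"
  shows "injective_chromatic_number G \<le> injective_chromatic_number (direct_product G H)"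
proof -
  let ?k = "injective_chromatic_number (direct_product G H)"
  interpret H: pair_graph H by fact
  obtain f where f: "injective_coloring (direct_product G H) ?k f"
    using ex_injective_coloring[OF pair_graph_direct_product[OF assms(1,2)]] by blast
  have h: "h \<in> pverts H" "h' \<in> pverts H" using H.wellformed'[OF hh] by auto
  have "injective_coloring G ?k (\<lambda>g. f (g, h'))"
  proof (rule injective_coloringI)
    show "f (v, h') \<in> {1..?k}" if "v \<in> pverts G" for v
      using injective_coloring_range[OF f, of "(v, h')"] that h by simp
    show "f (u, h') \<noteq> f (w, h')"
      if "v \<in> pverts G" "(v, u) \<in> parcs G" "(v, w) \<in> parcs G" "u \<noteq> w" for v u w
      using injective_coloringD[OF f, of "(v, h)" "(u, h')" "(w, h')"] that h hh by auto
  qed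
  then show ?thesis by (rule injective_chromatic_number_le)
qed

section \<open>Lower bound involving the maximum degree\<close>

lemma out_degree_with_proj: "out_degree (with_proj G) v = card {w. (v, w) \<in> parcs G}"
proof -
  have "out_arcs (with_proj G) v = Pair v ` {w. (v, w) \<in> parcs G}"
    by (auto simp: out_arcs_def)
  then show ?thesis by (simp add: out_degree_def card_image inj_on_def)
qed

lemma max_degree_attained:
  assumes "pair_graph G" "pverts G \<noteq> {}"
  obtains v where "v \<in> pverts G" "card {w. (v, w) \<in> parcs G} = max_degree G"
proof -
  interpret pair_graph G by fact
  have "max_degree G \<in> out_degree (with_proj G) ` pverts G"
    unfolding max_degree_def using assms(2) pair_finite_verts by (intro Max_in) auto
  then show thesis using that out_degree_with_proj by (metis imageE)
qed

text \<open>A collision of the truncated minima would push both sets into the top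
  \<open>m + 1\<close> numbers up to \<open>k\<close>, too few for \<open>2 * m\<close>
  elements.\<close>

lemma truncated_Min_neq:
  fixes S T :: "nat set"
  assumes "S \<subseteq> {1..k}" "T \<subseteq> {1..k}" "S \<inter> T = {}" "card S = m" "card T = m" "m \<ge> 2"
  shows "min (Min S) (k - m) \<noteq> min (Min T) (k - m)"
proof
  assume eq: "min (Min S) (k - m) = min (Min T) (k - m)"
  have fin: "finite S" "finite T" using assms(1,2) finite_subset by blast+
  have ne: "S \<noteq> {}" "T \<noteq> {}" using assms(4-6) by auto
  have "Min S \<noteq> Min T" using Min_in[OF fin(1) ne(1)] Min_in[OF fin(2) ne(2)] assms(3) by auto
  \<comment> \<open>Two different numbers with equal truncations both reach the cutoff.\<close>
  with eq have "k - m \<le> Min S" "k - m \<le> Min T" by linarith+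
  then have "S \<union> T \<subseteq> {k - m..k}"
    using assms(1,2) Min_le[OF fin(1)] Min_le[OF fin(2)] by fastforce
  \<comment> \<open>The bound \<open>m + 1\<close> also holds if \<open>m > k\<close>, where
    \<open>k - m\<close> is 0. It is below \<open>2 * m\<close> exactly from \<open>m = 2\<close>
    on.\<close>
  from card_mono[OF _ this] have "card (S \<union> T) \<le> m + 1" by simp
  moreover have "card (S \<union> T) = 2 * m" using card_Un_disjoint[OF fin assms(3)] assms(4,5) by simp
  ultimately show False using assms(6) by simp
qed

lemma injective_chromatic_number_add_max_degree_le:
  assumes "pair_graph G" "pair_graph H"
    and total: "\<And>g. g \<in> pverts G \<Longrightarrow> \<exists>g'. (g, g') \<in> parcs G"
    and "pverts G \<noteq> {}" "pverts H \<noteq> {}" and dG: "max_degree G \<ge> 2" and dH: "max_degree H \<ge> 2"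
  shows "injective_chromatic_number G + max_degree H \<le> injective_chromatic_number (direct_product G H)"
proof -
  interpret G: pair_graph G by fact
  interpret H: pair_graph H by fact
  let ?k = "injective_chromatic_number (direct_product G H)"
  define m where "m = max_degree H"
  have m: "m \<ge> 2" using dH by (simp add: m_def)
  obtain f where f: "injective_coloring (direct_product G H) ?k f"
    using ex_injective_coloring[OF pair_graph_direct_product[OF assms(1,2)]] by blast
  obtain h where h: "h \<in> pverts H" and N: "card {w. (h, w) \<in> parcs H} = m"
    using max_degree_attained[OF assms(2,5)] unfolding m_def by metis
  \<comment> \<open>\<open>S g\<close> is the set of colors on the neighborhood of \<open>h\<close>,
    copied into the layer of \<open>g\<close>; \<open>h\<close> has maximum degree.\<close>
  define S where "S g = (\<lambda>w. f (g, w)) ` {w. (h, w) \<in> parcs H}" for g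
  have S_sub: "S g \<subseteq> {1..?k}" if "g \<in> pverts G" for g
    using injective_coloring_range[OF f] that H.in_arcsD2 unfolding S_def by auto
  have S_card: "card (S g) = m" if g: "g \<in> pverts G" for g
  proof -
    \<comment> \<open>A neighbor \<open>g'\<close> of \<open>g\<close> makes \<open>(g', h)\<close>
      a common neighbor of the whole copy, so its colors are distinct. Isolated vertices are
      excluded for this purpose.\<close>
    obtain g' where "(g, g') \<in> parcs G" using total[OF g] by blast
    then have g': "(g', g) \<in> parcs G" "g' \<in> pverts G"
      using G.arcs_symmetric G.in_arcsD2 by blast+
    have "inj_on (\<lambda>w. f (g, w)) {w. (h, w) \<in> parcs H}"
    proof (rule inj_onI)
      fix u w assume "u \<in> {w. (h, w) \<in> parcs H}" "w \<in> {w. (h, w) \<in> parcs H}" "f (g, u) = f (g, w)"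
      then show "u = w"
        using injective_coloringD[OF f, of "(g', h)" "(g, u)" "(g, w)"] g' h by simp
    qed
    then show ?thesis unfolding S_def using N by (simp add: card_image)
  qed
  have S_disj: "S u \<inter> S w = {}"
    if "v \<in> pverts G" "(v, u) \<in> parcs G" "(v, w) \<in> parcs G" "u \<noteq> w" for v u w
  \<comment> \<open>A shared color would occur on two distinct neighbors of
    \<open>(v, h)\<close>.\<close>
  proof (rule equals0I)
    fix x assume "x \<in> S u \<inter> S w"
    then obtain y z where "(h, y) \<in> parcs H" "(h, z) \<in> parcs H" "f (u, y) = f (w, z)"
      unfolding S_def by auto
    then show False
      using injective_coloringD[OF f, of "(v, h)" "(u, y)" "(w, z)"] that h by simp
  qed
  \<comment> \<open>Two neighbors of one vertex of \<open>G\<close> have disjoint color sets of size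
    \<open>m\<close>. Hence \<open>?k - m\<close> is an exact subtraction with a positive result, so
    that truncated colors never drop to 0.\<close>
  have k: "2 * m \<le> ?k"
  proof -
    obtain v where v: "v \<in> pverts G" "card {w. (v, w) \<in> parcs G} = max_degree G"
      using max_degree_attained[OF assms(1,4)] by metis
    then have "\<not> card {w. (v, w) \<in> parcs G} \<le> Suc 0" using dG by simp
    moreover have "finite {w. (v, w) \<in> parcs G}"
      by (rule finite_subset[OF _ G.pair_finite_verts]) (auto dest: G.in_arcsD2)
    ultimately obtain u w where uw: "(v, u) \<in> parcs G" "(v, w) \<in> parcs G" "u \<noteq> w"
      by (auto simp: card_le_Suc0_iff_eq)
    have uw': "u \<in> pverts G" "w \<in> pverts G" using uw G.in_arcsD2 by blast+
    have "card (S u \<union> S w) = 2 * m"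
      using card_Un_disjoint[OF _ _ S_disj[OF v(1) uw]] S_card uw' S_sub finite_subset
      by (metis finite_atLeastAtMost mult_2)
    moreover have "card (S u \<union> S w) \<le> card {1..?k}"
      using S_sub uw' by (intro card_mono) auto
    ultimately show ?thesis by simp
  qed
  have "injective_coloring G (?k - m) (\<lambda>g. min (Min (S g)) (?k - m))"
  proof (rule injective_coloringI)
    fix v assume v: "v \<in> pverts G"
    \<comment> \<open>Infinite sets have \<open>card\<close> 0, so a cardinality of at least 2 gives
      finiteness as well as nonemptiness.\<close>
    have "finite (S v)" "S v \<noteq> {}"
      using S_card[OF v] m card.infinite[of "S v"] by fastforce+
    then have "Min (S v) \<ge> 1" using Min_in[of "S v"] S_sub[OF v] by fastforce
    then show "min (Min (S v)) (?k - m) \<in> {1..?k - m}" using k m by auto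
  next
    fix v u w assume a: "v \<in> pverts G" "(v, u) \<in> parcs G" "(v, w) \<in> parcs G" "u \<noteq> w"
    have "u \<in> pverts G" "w \<in> pverts G" using a G.in_arcsD2 by blast+
    then show "min (Min (S u)) (?k - m) \<noteq> min (Min (S w)) (?k - m)"
      by (intro truncated_Min_neq[OF S_sub S_sub S_disj[OF a] S_card S_card m])
  qed
  from injective_chromatic_number_le[OF this] show ?thesis using k m unfolding m_def by linarith
qed

section \<open>Connectedness, and products with the complete graph on two vertices\<close>

lemma connected_no_isolated:
  assumes "pair_graph G" "connected (with_proj G)" "card (pverts G) \<ge> 2" "v \<in> pverts G"
  shows "\<exists>w. (v, w) \<in> parcs G"
proof -
  interpret pair_graph G by fact
  have "\<not> pverts G \<subseteq> {v}"
    using card_mono[of "{v}" "pverts G"] assms(3) by auto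
  then obtain u where u: "u \<in> pverts G" "u \<noteq> v" by blast
  \<comment> \<open>Symmetry of the arcs turns connectedness into a directed walk from
    \<open>v\<close> to \<open>u\<close>; its first arc is the one sought.\<close>
  have "v \<rightarrow>\<^sup>*\<^bsub>with_proj G\<^esub> u"
    using symmetric_connected_imp_strongly_connected[OF sym_arcs assms(2)] u(1) assms(4)
    unfolding strongly_connected_def by simp
  then show ?thesis using u(2)
    by (cases rule: converse_reachable_cases) auto
qed

lemma injective_chromatic_number_K2:
  assumes "pair_graph G" "complete_digraph 2 (with_proj G)"
  shows "injective_chromatic_number G = 1"
proof -
  have G: "card (pverts G) = 2" "parcs G = {(u, v). (u, v) \<in> pverts G \<times> pverts G \<and> u \<noteq> v}"
    using assms(2) by (simp_all add: complete_digraph_pair_def)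
  then obtain a b where ab: "pverts G = {a, b}" by (auto simp: card_2_iff)
  \<comment> \<open>Each vertex has only one neighbor, so a constant coloring has no
    conflict.\<close>
  have "injective_coloring G 1 (\<lambda>_. 1)"
    by (rule injective_coloringI) (auto simp: G(2) ab)
  then show ?thesis
    using injective_chromatic_number_le injective_chromatic_number_pos[OF assms(1)] ab
    by (metis antisym insertI1)
qed

text \<open>As \<open>K2\<close> has injective chromatic number 1, the product upper bound and the
  layer lower bound both equal that of \<open>H\<close>, which is also the maximum.\<close>

lemma injective_chromatic_number_K2_direct_product:
  assumes "pair_graph G" "pair_graph H" "complete_digraph 2 (with_proj G)" "pverts H \<noteq> {}"
  shows "injective_chromatic_number (direct_product G H)
           = max (injective_chromatic_number G) (injective_chromatic_number H)"
proof -
  have G: "card (pverts G) = 2" "parcs G = {(u, v). (u, v) \<in> pverts G \<times> pverts G \<and> u \<noteq> v}"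
    using assms(3) by (simp_all add: complete_digraph_pair_def)
  then obtain a b where "(a, b) \<in> parcs G" by (auto simp: card_2_iff)
  \<comment> \<open>The layer bound takes its arc from the second factor, so the factors are
    exchanged first.\<close>
  then have "injective_chromatic_number H \<le> injective_chromatic_number (direct_product G H)"
    using injective_chromatic_number_le_direct_product[OF assms(2,1)]
      injective_chromatic_number_direct_product_commute[OF assms(1,2)] by metis
  moreover have "1 \<le> injective_chromatic_number H"
    using injective_chromatic_number_pos[OF assms(2)] assms(4) by blast
  ultimately show ?thesis
    using injective_chromatic_number_direct_product_le[OF assms(1,2)]
      injective_chromatic_number_K2[OF assms(1,3)] by simp
qed

section \<open>Sharpness: the path on three vertices\<close>

definition path3 :: "nat pair_pre_digraph" where
  "path3 = \<lparr> pverts = {0, 1, 2}, parcs = {(0, 1), (1, 0), (1, 2), (2, 1)} \<rparr>"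

lemma path3_simps [simp]:
  "pverts path3 = {0, 1, 2}" "parcs path3 = {(0, 1), (1, 0), (1, 2), (2, 1)}"
  by (simp_all add: path3_def)

lemma pair_graph_path3: "pair_graph path3"
  by unfold_locales (auto simp: symmetric_def sym_def)

lemma connected_path3: "connected (with_proj path3)"
proof -
  interpret pair_graph path3 by (rule pair_graph_path3)
  \<comment> \<open>Connectedness is strong connectedness of the symmetric closure, and this graph
    is its own closure.\<close>
  have "mk_symmetric (with_proj path3) = path3"
    by (auto simp: mk_symmetric_def path3_def)
  \<comment> \<open>Any two vertices are then joined by a walk through the center 1.\<close>
  moreover have "u \<rightarrow>\<^sup>*\<^bsub>with_proj path3\<^esub> 1 \<and> 1 \<rightarrow>\<^sup>*\<^bsub>with_proj path3\<^esub> u" if "u \<in> pverts path3" for u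
    using that by auto
  ultimately show ?thesis
    unfolding connected_def strongly_connected_def using reachable_trans
    by (metis empty_iff insertI1 path3_simps(1) with_proj_simps(1))
qed

lemma max_degree_path3: "max_degree path3 = 2"
proof -
  have "{w. (0, w) \<in> parcs path3} = {1}" "{w. (1, w) \<in> parcs path3} = {0, 2}"
    "{w. (2, w) \<in> parcs path3} = {1}"
    by auto
  then show ?thesis
    unfolding max_degree_def by (simp add: out_degree_with_proj del: path3_simps(2))
qed

lemma injective_chromatic_number_path3: "injective_chromatic_number path3 = 2"
proof (rule antisym)
  \<comment> \<open>Only the ends 0 and 2 share a neighbor, so the center may repeat the color of
    2.\<close>
  have "injective_coloring path3 2 (\<lambda>v. if v = 0 then 1 else 2)"
    by (rule injective_coloringI) auto
  then show "injective_chromatic_number path3 \<le> 2" by (rule injective_chromatic_number_le)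
  obtain f where f: "injective_coloring path3 (injective_chromatic_number path3) f"
    using ex_injective_coloring[OF pair_graph_path3] by blast
  have "f 0 \<noteq> f 2" using injective_coloringD[OF f, of 1 0 2] by auto
  then show "2 \<le> injective_chromatic_number path3"
    using injective_coloring_range[OF f, of 0] injective_coloring_range[OF f, of 2] by auto
qed

text \<open>The general bounds pinch the value, because 2 + 2 = 2 * 2.\<close>

lemma injective_chromatic_number_path3_path3:
  "injective_chromatic_number (direct_product path3 path3) = 4"
proof (rule antisym)
  show "injective_chromatic_number (direct_product path3 path3) \<le> 4"
    using injective_chromatic_number_direct_product_le[OF pair_graph_path3 pair_graph_path3]
    by (simp add: injective_chromatic_number_path3)
  have "\<exists>w. (v, w) \<in> parcs path3" if "v \<in> pverts path3" for v
    using that by auto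
  then show "4 \<le> injective_chromatic_number (direct_product path3 path3)"
    using injective_chromatic_number_add_max_degree_le[OF pair_graph_path3 pair_graph_path3]
    by (simp add: injective_chromatic_number_path3 max_degree_path3)
qed

theorem theorem2p2:
  shows
   "(\<forall>(G :: 'a pair_pre_digraph) (H :: 'b pair_pre_digraph).
      pair_graph G \<and> connected (with_proj G) \<and> card (pverts G) \<ge> 2 \<and>
      pair_graph H \<and> connected (with_proj H) \<and> card (pverts H) \<ge> 2 \<longrightarrow>
        (complete_digraph 2 (with_proj G) \<or> complete_digraph 2 (with_proj H) \<longrightarrow>
           injective_chromatic_number (direct_product G H)
             = max (injective_chromatic_number G) (injective_chromatic_number H)) \<and>
        (max_degree G \<ge> 2 \<and> max_degree H \<ge> 2 \<longrightarrow>
           max (injective_chromatic_number G + max_degree H)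
               (injective_chromatic_number H + max_degree G)
             \<le> injective_chromatic_number (direct_product G H) \<and>
           injective_chromatic_number (direct_product G H)
             \<le> injective_chromatic_number G * injective_chromatic_number H)) \<and>
    (\<exists>(G :: nat pair_pre_digraph) (H :: nat pair_pre_digraph).
      pair_graph G \<and> connected (with_proj G) \<and> pair_graph H \<and> connected (with_proj H) \<and>
      max_degree G \<ge> 2 \<and> max_degree H \<ge> 2 \<and>
      max (injective_chromatic_number G + max_degree H)
          (injective_chromatic_number H + max_degree G)
        = injective_chromatic_number (direct_product G H)) \<and>
    (\<exists>(G :: nat pair_pre_digraph) (H :: nat pair_pre_digraph).
      pair_graph G \<and> connected (with_proj G) \<and> pair_graph H \<and> connected (with_proj H) \<and>
      max_degree G \<ge> 2 \<and> max_degree H \<ge> 2 \<and>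
      injective_chromatic_number (direct_product G H)
        = injective_chromatic_number G * injective_chromatic_number H)"
proof (intro conjI)
  show "\<forall>(G :: 'a pair_pre_digraph) (H :: 'b pair_pre_digraph).
      pair_graph G \<and> connected (with_proj G) \<and> card (pverts G) \<ge> 2 \<and>
      pair_graph H \<and> connected (with_proj H) \<and> card (pverts H) \<ge> 2 \<longrightarrow>
        (complete_digraph 2 (with_proj G) \<or> complete_digraph 2 (with_proj H) \<longrightarrow>
           injective_chromatic_number (direct_product G H)
             = max (injective_chromatic_number G) (injective_chromatic_number H)) \<and>
        (max_degree G \<ge> 2 \<and> max_degree H \<ge> 2 \<longrightarrow>
           max (injective_chromatic_number G + max_degree H)
               (injective_chromatic_number H + max_degree G)
             \<le> injective_chromatic_number (direct_product G H) \<and>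
           injective_chromatic_number (direct_product G H)
             \<le> injective_chromatic_number G * injective_chromatic_number H)"
  proof (intro allI impI, elim conjE, intro conjI impI)
    fix G :: "'a pair_pre_digraph" and H :: "'b pair_pre_digraph"
    assume G: "pair_graph G" "connected (with_proj G)" "card (pverts G) \<ge> 2"
      and H: "pair_graph H" "connected (with_proj H)" "card (pverts H) \<ge> 2"
    have ne: "pverts G \<noteq> {}" "pverts H \<noteq> {}" using G(3) H(3) by auto
    note commute = injective_chromatic_number_direct_product_commute[OF G(1) H(1)]
    show "injective_chromatic_number (direct_product G H)
        = max (injective_chromatic_number G) (injective_chromatic_number H)"
      if "complete_digraph 2 (with_proj G) \<or> complete_digraph 2 (with_proj H)"
      \<comment> \<open>If \<open>K2\<close> is the second factor, commutativity reduces to the case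
        of the first.\<close>
      using that injective_chromatic_number_K2_direct_product[OF G(1) H(1) _ ne(2)]
        injective_chromatic_number_K2_direct_product[OF H(1) G(1) _ ne(1)]
      by (auto simp: commute max.commute)
    show "injective_chromatic_number (direct_product G H)
        \<le> injective_chromatic_number G * injective_chromatic_number H"
      by (rule injective_chromatic_number_direct_product_le[OF G(1) H(1)])
    assume "2 \<le> max_degree G \<and> 2 \<le> max_degree H"
    then have d: "2 \<le> max_degree G" "2 \<le> max_degree H" by auto
    show "max (injective_chromatic_number G + max_degree H) (injective_chromatic_number H + max_degree G)
        \<le> injective_chromatic_number (direct_product G H)"
      \<comment> \<open>The two entries of the maximum come from one bound, applied with either
        order of the factors.\<close>
      using injective_chromatic_number_add_max_degree_le[OF G(1) H(1) connected_no_isolated[OF G] ne d]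
        injective_chromatic_number_add_max_degree_le
          [OF H(1) G(1) connected_no_isolated[OF H] ne(2,1) d(2,1)]
      by (simp add: commute)
  qed
next
  show "\<exists>(G :: nat pair_pre_digraph) (H :: nat pair_pre_digraph).
      pair_graph G \<and> connected (with_proj G) \<and> pair_graph H \<and> connected (with_proj H) \<and>
      max_degree G \<ge> 2 \<and> max_degree H \<ge> 2 \<and>
      max (injective_chromatic_number G + max_degree H)
          (injective_chromatic_number H + max_degree G)
        = injective_chromatic_number (direct_product G H)"
    by (rule exI[of _ path3], rule exI[of _ path3])
      (simp add: pair_graph_path3 connected_path3 max_degree_path3
        injective_chromatic_number_path3 injective_chromatic_number_path3_path3)
  show "\<exists>(G :: nat pair_pre_digraph) (H :: nat pair_pre_digraph).
      pair_graph G \<and> connected (with_proj G) \<and> pair_graph H \<and> connected (with_proj H) \<and>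
      max_degree G \<ge> 2 \<and> max_degree H \<ge> 2 \<and>
      injective_chromatic_number (direct_product G H)
        = injective_chromatic_number G * injective_chromatic_number H"
    by (rule exI[of _ path3], rule exI[of _ path3])
      (simp add: pair_graph_path3 connected_path3 max_degree_path3
        injective_chromatic_number_path3 injective_chromatic_number_path3_path3)
qed

end
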